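(* In the random model of square-free walks in base $10$ in which one digit is appended at a time to the right, for any starting point $x$ the probability that there is an infinite random square-free walk starting from $x$ is at least $1 - l \approx 0.99991$ (value to five decimal places), where $l = \lim_{k\to\infty} P_k$.
   Context: Random model: let $p = 6/\pi^2$. Fix a starting point, a positive integer $x$, which is regarded as square-free. Each number obtainable from $x$ by appending one or more decimal digits (from $\{0,1,\ldots,9\}$) to the right is, independently of all the others, declared "square-free" with probability $p$ (and "not square-free" with probability $1-p$). A random square-free walk from $x$ is a finite or infinite sequence $x = x_1, x_2, x_3, \ldots$ in which each $x_{i+1} = 10x_i + d_i$ with $d_i \in \{0,\ldots,9\}$ and every $x_{i}$ with $i\ge 2$ is declared square-free. The length of a walk is its number of terms (counting the starting point). For $k \ge 1$, $P_k$ denotes the probability that the longest random square-free walk from $x$ has length at most $k$; this does not depend on $x$. The number $l$ is the limit of $P_k$ as $k \to \infty$ (the limit exists since $P_k$ is non-decreasing and bounded). *)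

theory Defs
  imports "HOL-Probability.Probability"
begin

inductive_set extensions :: "nat \<Rightarrow> nat set" for x :: nat where
  base: "d < 10 \<Longrightarrow> 10 * x + d \<in> extensions x"
| step: "y \<in> extensions x \<Longrightarrow> d < 10 \<Longrightarrow> 10 * y + d \<in> extensions x"

text \<open>
  An outcome \<open>\<omega>\<close> declares \<open>y\<close> square-free iff \<open>\<omega> y\<close> holds. Only the proper extensions of
  the starting point are random; the starting point itself is always regarded as square-free.
\<close>

definition sqfree_model :: "nat \<Rightarrow> (nat \<Rightarrow> bool) measure" where
  "sqfree_model x = (\<Pi>\<^sub>M y\<in>extensions x. measure_pmf (bernoulli_pmf (6 / pi\<^sup>2)))"

text \<open>
  \<open>sqfree_walk \<omega> x n w\<close>: the first \<open>n\<close> terms \<open>w 0, w 1, \<dots>\<close> form a walk from \<open>x\<close> of length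
  \<open>n\<close>, where \<open>n = \<infinity>\<close> means an infinite walk. The indices start at \<open>0\<close>, and for finite \<open>n\<close>
  the values \<open>w i\<close> with \<open>i \<ge> n\<close> are unconstrained.
\<close>

definition sqfree_walk :: "(nat \<Rightarrow> bool) \<Rightarrow> nat \<Rightarrow> enat \<Rightarrow> (nat \<Rightarrow> nat) \<Rightarrow> bool" where
  "sqfree_walk \<omega> x n w \<longleftrightarrow> 1 \<le> n \<and> w 0 = x \<and>
     (\<forall>i. enat (Suc i) < n \<longrightarrow> (\<exists>d<10. w (Suc i) = 10 * w i + d) \<and> \<omega> (w (Suc i)))"

definition longest_walk_length :: "(nat \<Rightarrow> bool) \<Rightarrow> nat \<Rightarrow> enat" where
  "longest_walk_length \<omega> x = Sup {n. \<exists>w. sqfree_walk \<omega> x n w}"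

definition walk_prob :: "nat \<Rightarrow> nat \<Rightarrow> real" where
  "walk_prob x k = \<P>(\<omega> in sqfree_model x. longest_walk_length \<omega> x \<le> enat k)"

end

(* Cutting off the first step, no walk of length k + 2 starts at y iff for each of the ten digits d
   the number 10y + d is not square-free or no walk of length k + 1 starts at it. These ten events
   live on disjoint blocks of coordinates, so P_{k+1} = (1 - p + p P_k)^10. By Koenig's lemma an
   infinite walk exists as soon as arbitrarily long walks do, hence its probability is exactly the
   limit 1 - l; the numerical value follows from 8.5e-5 < P_1 and from the fact that [0, 9e-5] is
   invariant under the recursion. *)

theory Submission
  imports Defs
begin

subsection \<open>Walks and extensions\<close>

text \<open>The argument counts appended digits, so \<open>has_walk\<close> with \<open>n\<close>
  corresponds to walks of \<open>n + 1\<close> terms. Recursion on the first appended digit exposes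
  the ten subtrees used for independence.\<close>

fun has_walk :: "(nat \<Rightarrow> bool) \<Rightarrow> nat \<Rightarrow> nat \<Rightarrow> bool" where
  "has_walk \<omega> y 0 = True"
| "has_walk \<omega> y (Suc n) = (\<exists>d<10. \<omega> (10 * y + d) \<and> has_walk \<omega> (10 * y + d) n)"

lemma has_walk_iff:
  "has_walk \<omega> y n \<longleftrightarrow>
     (\<exists>w. w 0 = y \<and> (\<forall>i<n. (\<exists>d<10. w (Suc i) = 10 * w i + d) \<and> \<omega> (w (Suc i))))"
proof (induction n arbitrary: y)
  case 0
  show ?case by (auto intro: exI[of _ "\<lambda>_. y"])
next
  case (Suc n)
  show ?case (is "_ = (\<exists>w. ?W w)")
  proof
    assume "has_walk \<omega> y (Suc n)"
    then obtain d w where d: "d < 10" "\<omega> (10 * y + d)" and w: "w 0 = 10 * y + d"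
      "\<forall>i<n. (\<exists>d<10. w (Suc i) = 10 * w i + d) \<and> \<omega> (w (Suc i))"
      unfolding has_walk.simps Suc.IH by blast
    have "?W (case_nat y w)"
      using d w by (auto simp: less_Suc_eq_0_disj)
    then show "\<exists>w. ?W w" by blast
  next
    assume "\<exists>w. ?W w"
    then obtain w where w: "?W w" by blast
    then obtain d where d: "d < 10" "w (Suc 0) = 10 * y + d" "\<omega> (10 * y + d)" by fastforce
    have "has_walk \<omega> (10 * y + d) n"
      unfolding Suc.IH using w d by (intro exI[of _ "w \<circ> Suc"]) auto
    with d show "has_walk \<omega> y (Suc n)" by auto
  qed
qed

lemma has_walk_antimono: "n \<le> m \<Longrightarrow> has_walk \<omega> y m \<Longrightarrow> has_walk \<omega> y n"
proof (induction n arbitrary: m y)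
  case (Suc n)
  then obtain m' where "m = Suc m'" "n \<le> m'" by (cases m) auto
  with Suc.IH Suc.prems(2) show ?case by auto
qed simp

lemma sqfree_walk_Suc_iff:
  "(\<exists>w. sqfree_walk \<omega> x (enat (Suc n)) w) \<longleftrightarrow> has_walk \<omega> x n"
  unfolding has_walk_iff sqfree_walk_def by (auto simp: one_enat_def)

text \<open>Any walk with more than \<open>k\<close> terms, an infinite one included, truncates to
  one with exactly \<open>k + 1\<close> terms, that is, \<open>k\<close> appended digits.\<close>

lemma longest_walk_length_le_iff:
  "longest_walk_length \<omega> x \<le> enat k \<longleftrightarrow> \<not> has_walk \<omega> x k"
proof -
  have "longest_walk_length \<omega> x \<le> enat k \<longleftrightarrow> (\<forall>n w. sqfree_walk \<omega> x n w \<longrightarrow> n \<le> enat k)"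
    unfolding longest_walk_length_def by (auto simp: Sup_le_iff)
  also have "\<dots> \<longleftrightarrow> \<not> (\<exists>w. sqfree_walk \<omega> x (enat (Suc k)) w)"
  proof
    assume R: "\<not> (\<exists>w. sqfree_walk \<omega> x (enat (Suc k)) w)"
    show "\<forall>n w. sqfree_walk \<omega> x n w \<longrightarrow> n \<le> enat k"
    proof (intro allI impI, rule ccontr)
      fix n w assume w: "sqfree_walk \<omega> x n w" and "\<not> n \<le> enat k"
      then have "enat (Suc k) \<le> n" by (simp add: Suc_ile_eq)
      then have "enat (Suc i) < n" if "i < k" for i
        using that by (metis Suc_less_eq enat_ord_simps(2) order_less_le_trans)
      with w have "sqfree_walk \<omega> x (enat (Suc k)) w"
        unfolding sqfree_walk_def by (auto simp: one_enat_def)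
      with R show False by blast
    qed
  qed fastforce
  finally show ?thesis by (simp add: sqfree_walk_Suc_iff)
qed

text \<open>Koenig's lemma for the tree with ten children per node: having arbitrarily long walks
  passes to some child, and iterating this choice builds the infinite walk.\<close>

lemma ex_infinite_walk_iff:
  "(\<exists>w. sqfree_walk \<omega> x \<infinity> w) \<longleftrightarrow> (\<forall>n. has_walk \<omega> x n)"
proof
  assume "\<exists>w. sqfree_walk \<omega> x \<infinity> w"
  then show "\<forall>n. has_walk \<omega> x n"
    unfolding has_walk_iff sqfree_walk_def by auto
next
  assume x: "\<forall>n. has_walk \<omega> x n"
  have step: "\<exists>z. (\<forall>n. has_walk \<omega> z n) \<and> (\<exists>d<10. z = 10 * y + d) \<and> \<omega> z"
    if y: "\<forall>n. has_walk \<omega> y n" for y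
  proof (rule ccontr)
    assume "\<not> ?thesis"
    then have "\<forall>d\<in>{..<10}. \<exists>n. \<omega> (10 * y + d) \<longrightarrow> \<not> has_walk \<omega> (10 * y + d) n" by auto
    then obtain f where f: "\<And>d. d < 10 \<Longrightarrow> \<omega> (10 * y + d) \<Longrightarrow> \<not> has_walk \<omega> (10 * y + d) (f d)"
      unfolding bchoice_iff by auto
    \<comment> \<open>If every admissible child \<open>d\<close> had a failing length
      \<open>f d\<close>, a walk with one step more than the maximum would still pass through some
      child, exceeding that child's bound.\<close>
    from y obtain d where d: "d < 10" "\<omega> (10 * y + d)"
      "has_walk \<omega> (10 * y + d) (Max (f ` {..<10}))"
      by (metis has_walk.simps(2))
    have "f d \<le> Max (f ` {..<10})" using d(1) by (intro Max_ge) auto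
    with d f has_walk_antimono show False by blast
  qed
  have "\<exists>w. \<forall>i. ((\<forall>n. has_walk \<omega> (w i) n) \<and> (i = 0 \<longrightarrow> w i = x)) \<and>
      ((\<exists>d<10. w (Suc i) = 10 * w i + d) \<and> \<omega> (w (Suc i)))"
    by (rule dependent_nat_choice) (use x step in auto)
  then show "\<exists>w. sqfree_walk \<omega> x \<infinity> w"
    unfolding sqfree_walk_def by auto
qed

section \<open>Disjoint subtrees of the digit tree\<close>

lemma extensions_trans: "z \<in> extensions y \<Longrightarrow> y \<in> extensions x \<Longrightarrow> z \<in> extensions x"
  by (induction rule: extensions.induct) (auto intro: extensions.intros)

lemma extensions_div: "z \<in> extensions x \<Longrightarrow> \<exists>k>0. z div 10 ^ k = x"
proof (induction rule: extensions.induct)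
  case (base d)
  then show ?case by (intro exI[of _ 1]) auto
next
  case (step y d)
  then obtain k where "y div 10 ^ k = x" by blast
  with step.hyps show ?case by (intro exI[of _ "Suc k"]) (simp add: div_mult2_eq)
qed

text \<open>Deleting at least one digit strictly decreases a positive number. Positivity matters:
  appending the digit 0 to 0 gives 0 again.\<close>

lemma notin_extensions_self: "0 < x \<Longrightarrow> x \<notin> extensions x"
  by (auto dest!: extensions_div) (metis div_less_dividend one_less_numeral_iff one_less_power
      semiring_norm(76) nat_neq_iff)

text \<open>A common element of two blocks would have both siblings as decimal prefixes. They arise
  by deleting equally many digits, and hence coincide.\<close>

lemma disjoint_family_extensions:
  assumes "0 < y"
  shows "disjoint_family_on (\<lambda>d. insert (10 * y + d) (extensions (10 * y + d))) {..<10}"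
proof -
  have div: "\<exists>k. z div 10 ^ k = a" if "z \<in> insert a (extensions a)" for z a :: nat
    using that by (auto dest: extensions_div intro: exI[of _ 0])
  have le: "i \<le> j" if "d < 10" "e < 10" "z div 10 ^ i = 10 * y + e" "z div 10 ^ j = 10 * y + d"
    for d e i j z :: nat
  proof (rule ccontr)
    assume "\<not> i \<le> j"
    then obtain m where m: "i = j + Suc m" by (metis less_imp_Suc_add not_le add_Suc_right)
    \<comment> \<open>Deleting more digits to reach \<open>e\<close> than to reach \<open>d\<close>
      would make \<open>10 * y + e\<close> at most \<open>y\<close>, impossible for positive
      \<open>y\<close>.\<close>
    have "10 * y + e = (10 * y + d) div 10 div 10 ^ m"
      unfolding that(3,4)[symmetric] m power_add power_Suc div_mult2_eq ..
    also have "\<dots> \<le> (10 * y + d) div 10" by (rule div_le_dividend)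
    finally show False using that(1) assms by simp
  qed
  show ?thesis
    unfolding disjoint_family_on_def
  proof (intro ballI impI, rule ccontr)
    fix d e :: nat assume *: "d \<in> {..<10}" "e \<in> {..<10}" "d \<noteq> e"
      and "insert (10 * y + d) (extensions (10 * y + d)) \<inter>
           insert (10 * y + e) (extensions (10 * y + e)) \<noteq> {}"
    then obtain z where "z \<in> insert (10 * y + d) (extensions (10 * y + d))"
      "z \<in> insert (10 * y + e) (extensions (10 * y + e))" by blast
    then obtain i j where ij: "z div 10 ^ i = 10 * y + d" "z div 10 ^ j = 10 * y + e"
      using div by meson
    with * have "i = j" by (intro le_antisym le[of e d z i j] le[of d e z j i]) simp_all
    with ij * show False by simp
  qed
qed

text \<open>Only declarations of proper extensions of \<open>y\<close> are consulted; this locality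
  lets walk events be assigned to coordinate blocks.\<close>

lemma has_walk_restrict:
  "extensions y \<subseteq> S \<Longrightarrow> has_walk (restrict \<omega> S) y n = has_walk \<omega> y n"
proof (induction n arbitrary: y)
  case (Suc n)
  have "has_walk (restrict \<omega> S) (10 * y + d) n = has_walk \<omega> (10 * y + d) n" if "d < 10" for d
    using Suc.prems that by (intro Suc.IH) (auto intro: extensions_trans extensions.base)
  moreover have "10 * y + d \<in> S" if "d < 10" for d
    using Suc.prems that by (auto intro: extensions.base)
  ultimately show ?case by (auto simp del: restrict_apply simp: restrict_apply')
qed simp

subsection \<open>The random model\<close>

lemma (in prob_space) prob_cong_space:
  "(\<And>\<omega>. \<omega> \<in> space M \<Longrightarrow> Q \<omega> = R \<omega>) \<Longrightarrow> \<P>(\<omega> in M. Q \<omega>) = \<P>(\<omega> in M. R \<omega>)"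
  by (metis (mono_tags, lifting) Collect_cong)

text \<open>Coordinates of a product measure are independent, and so are their restrictions to
  disjoint blocks. \<open>E_restrict\<close> says that each event depends on its own block
  only.\<close>

lemma prob_disjoint_blocks:
  assumes N: "\<And>i. i \<in> I \<Longrightarrow> prob_space (N i)"
    and K: "finite K" "K \<noteq> {}"
    and S: "\<And>k. k \<in> K \<Longrightarrow> S k \<subseteq> I" "disjoint_family_on S K"
    and E: "\<And>k. k \<in> K \<Longrightarrow> Measurable.pred (PiM (S k) N) (E k)"
    and E_restrict: "\<And>k \<omega>. k \<in> K \<Longrightarrow> E k (restrict \<omega> (S k)) = E k \<omega>"
  shows "\<P>(\<omega> in PiM I N. \<forall>k\<in>K. E k \<omega>) = (\<Prod>k\<in>K. \<P>(\<omega> in PiM I N. E k \<omega>))"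
proof -
  interpret prob_space "PiM I N" by (rule prob_space_PiM) (rule N)
  have "indep_vars N (\<lambda>i \<omega>. \<omega> i) I"
  proof (cases "I = {}")
    case True
    show ?thesis unfolding indep_vars_def indep_sets_def by (simp add: True)
  next
    case False
    \<comment> \<open>Independence means that the joint law of the coordinates is the product of
      their laws. Here the joint map is the identity on the space, so both are
      \<open>PiM I N\<close>.\<close>
    have "distr (PiM I N) (PiM I N) (\<lambda>\<omega>. \<lambda>i\<in>I. \<omega> i) = distr (PiM I N) (PiM I N) (\<lambda>\<omega>. \<omega>)"
      by (intro distr_cong) (auto simp: space_PiM restrict_PiE_iff)
    also have "\<dots> = PiM I (\<lambda>i. distr (PiM I N) (N i) (\<lambda>\<omega>. \<omega> i))"
      by (simp add: distr_id2, intro PiM_cong) (simp_all add: distr_PiM_component N)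
    finally show ?thesis using False by (subst indep_vars_iff_distr_eq_PiM') auto
  qed
  then have ind: "indep_vars (\<lambda>k. PiM (S k) N) (\<lambda>k \<omega>. restrict (\<lambda>i. \<omega> i) (S k)) K"
    using S by (intro indep_vars_restrict) auto
  define A where "A k = {\<omega> \<in> space (PiM (S k) N). E k \<omega>}" for k
  have A: "A k \<in> sets (PiM (S k) N)" if "k \<in> K" for k
    unfolding A_def using E[OF that] by measurable
  have eq: "(\<lambda>\<omega>. restrict (\<lambda>i. \<omega> i) (S k)) -` A k \<inter> space (PiM I N) = {\<omega> \<in> space (PiM I N). E k \<omega>}"
    if "k \<in> K" for k
  proof -
    have "restrict \<omega> (S k) \<in> space (PiM (S k) N)" if "\<omega> \<in> space (PiM I N)" for \<omega>
      using that S(1)[OF \<open>k \<in> K\<close>] by (auto simp: space_PiM PiE_iff)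
    then show ?thesis by (auto simp: A_def E_restrict[OF that])
  qed
  have "{\<omega> \<in> space (PiM I N). \<forall>k\<in>K. E k \<omega>} = (\<Inter>k\<in>K. {\<omega> \<in> space (PiM I N). E k \<omega>})"
    using K by auto
  also have "\<dots> = (\<Inter>k\<in>K. (\<lambda>\<omega>. restrict (\<lambda>i. \<omega> i) (S k)) -` A k \<inter> space (PiM I N))"
    by (simp add: eq)
  finally have "\<P>(\<omega> in PiM I N. \<forall>k\<in>K. E k \<omega>) =
      prob (\<Inter>k\<in>K. (\<lambda>\<omega>. restrict (\<lambda>i. \<omega> i) (S k)) -` A k \<inter> space (PiM I N))"
    by (rule arg_cong)
  also have "\<dots> = (\<Prod>k\<in>K. prob ((\<lambda>\<omega>. restrict (\<lambda>i. \<omega> i) (S k)) -` A k \<inter> space (PiM I N)))"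
    by (rule indep_varsD_finite[OF ind K(2,1) A])
  also have "\<dots> = (\<Prod>k\<in>K. \<P>(\<omega> in PiM I N. E k \<omega>))"
    by (intro prod.cong refl arg_cong[where f = prob] eq)
  finally show ?thesis .
qed

section \<open>The coin bias, measurability, and the recursion for stopping\<close>

definition sqfree_prob :: real where
  "sqfree_prob = 6 / pi\<^sup>2"

abbreviation sqfree_coin :: "bool measure" where
  "sqfree_coin \<equiv> measure_pmf (bernoulli_pmf sqfree_prob)"

lemma sqfree_model_eq: "sqfree_model x = PiM (extensions x) (\<lambda>_. sqfree_coin)"
  by (simp add: sqfree_model_def sqfree_prob_def)

lemma sqfree_prob_bounds: "0.6079 \<le> sqfree_prob" "sqfree_prob \<le> 0.60796"
proof -
  have "3.14159 \<le> pi" "pi \<le> 3.1416"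
    using pi_approx by simp_all
  then have "3.14159\<^sup>2 \<le> pi\<^sup>2" "pi\<^sup>2 \<le> 3.1416\<^sup>2"
    by (auto intro!: power_mono)
  then have "9.8695 \<le> pi\<^sup>2" "pi\<^sup>2 \<le> 9.87"
    by (simp_all add: power_divide)
  then show "0.6079 \<le> sqfree_prob" "sqfree_prob \<le> 0.60796"
    unfolding sqfree_prob_def by (simp_all add: pos_le_divide_eq pos_divide_le_eq)
qed

lemma pred_coordinate: "z \<in> I \<Longrightarrow> Measurable.pred (PiM I (\<lambda>_. sqfree_coin)) (\<lambda>\<omega>. \<omega> z)"
  by (subst measurable_cong_sets[OF refl, of _ sqfree_coin])
    (simp_all add: measurable_component_singleton)

lemma pred_has_walk:
  "extensions y \<subseteq> I \<Longrightarrow> Measurable.pred (PiM I (\<lambda>_. sqfree_coin)) (\<lambda>\<omega>. has_walk \<omega> y n)"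
proof (induction n arbitrary: y)
  case (Suc n)
  have "Measurable.pred (PiM I (\<lambda>_. sqfree_coin)) (\<lambda>\<omega>. has_walk \<omega> (10 * y + d) n)" if "d < 10" for d
    using Suc.prems that by (intro Suc.IH) (auto intro: extensions_trans extensions.base)
  moreover have "Measurable.pred (PiM I (\<lambda>_. sqfree_coin)) (\<lambda>\<omega>. \<omega> (10 * y + d))" if "d < 10" for d
    using Suc.prems that by (auto intro!: pred_coordinate extensions.base)
  ultimately have "Measurable.pred (PiM I (\<lambda>_. sqfree_coin))
      (\<lambda>\<omega>. \<exists>d\<in>{..<10}. \<omega> (10 * y + d) \<and> has_walk \<omega> (10 * y + d) n)"
    by (intro pred_intros_finite pred_intros_logic) auto
  then show ?case by (simp only: has_walk.simps Bex_def lessThan_iff)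
qed simp

text \<open>This is the sequence \<open>P_k\<close>, extended by \<open>P_0 = 0\<close> because the
  starting point alone is always a walk of length 1.\<close>

primrec stop_prob :: "nat \<Rightarrow> real" where
  "stop_prob 0 = 0"
| "stop_prob (Suc k) = (1 - sqfree_prob * (1 - stop_prob k)) ^ 10"

text \<open>The index set \<open>I\<close> may exceed \<open>extensions y\<close>, so that the
  induction hypothesis applies to the children of \<open>y\<close> inside one fixed product
  space.\<close>

lemma prob_no_walk:
  assumes "0 < y" "extensions y \<subseteq> I"
  shows "\<P>(\<omega> in PiM I (\<lambda>_. sqfree_coin). \<not> has_walk \<omega> y n) = stop_prob n"
  using assms
proof (induction n arbitrary: y)
  case (Suc n)
  let ?M = "PiM I (\<lambda>_. sqfree_coin)"
  interpret prob_space ?M by (rule prob_space_PiM) (rule measure_pmf.prob_space_axioms)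
  have z: "\<P>(\<omega> in ?M. \<not> (\<omega> z \<and> has_walk \<omega> z n)) = 1 - sqfree_prob * (1 - stop_prob n)"
    if "d < 10" and z_def: "z = 10 * y + d" for z d
  proof -
    have I: "z \<in> I" "extensions z \<subseteq> I" and "0 < z"
      using Suc.prems that by (auto intro: extensions_trans extensions.base)
    have [measurable]: "Measurable.pred ?M (\<lambda>\<omega>. \<omega> z)" "Measurable.pred ?M (\<lambda>\<omega>. has_walk \<omega> z n)"
      using I by (auto intro: pred_coordinate pred_has_walk)
    have coin: "\<P>(\<omega> in ?M. \<omega> z) = sqfree_prob"
    proof -
      have "\<P>(\<omega> in ?M. \<omega> z) = measure (distr ?M sqfree_coin (\<lambda>\<omega>. \<omega> z)) {True}"
        using I by (subst measure_distr) (auto intro!: arg_cong[where f = "measure ?M"])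
      also have "\<dots> = measure sqfree_coin {True}"
        using I by (subst distr_PiM_component) (auto intro: measure_pmf.prob_space_axioms)
      finally show ?thesis using sqfree_prob_bounds by (simp add: measure_pmf_single)
    qed
    have walk: "\<P>(\<omega> in ?M. has_walk \<omega> z n) = 1 - stop_prob n"
      using Suc.IH[OF \<open>0 < z\<close> I(2)] prob_neg[of "\<lambda>\<omega>. has_walk \<omega> z n"] by simp
    \<comment> \<open>First use of independence: the coin of \<open>z\<close> itself against the
      coins strictly below \<open>z\<close>.\<close>
    let ?S = "case_bool {z} (extensions z)"
    let ?E = "\<lambda>b \<omega>. if b then \<omega> z else has_walk \<omega> z n"
    have "\<P>(\<omega> in ?M. \<omega> z \<and> has_walk \<omega> z n) = \<P>(\<omega> in ?M. \<forall>b\<in>UNIV. ?E b \<omega>)"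
      by (intro prob_cong_space) (auto simp: UNIV_bool)
    also have "\<dots> = (\<Prod>b\<in>UNIV. \<P>(\<omega> in ?M. ?E b \<omega>))"
    proof (rule prob_disjoint_blocks[where S = ?S])
      show "disjoint_family_on ?S UNIV"
        using notin_extensions_self[OF \<open>0 < z\<close>] by (auto simp: disjoint_family_on_def split: bool.split)
      show "Measurable.pred (PiM (?S b) (\<lambda>_. sqfree_coin)) (?E b)" for b
        by (cases b) (auto intro: pred_coordinate pred_has_walk)
      show "?E b (restrict \<omega> (?S b)) = ?E b \<omega>" for b \<omega>
        by (cases b) (auto simp: has_walk_restrict)
    qed (use I in \<open>auto intro: measure_pmf.prob_space_axioms split: bool.splits\<close>)
    also have "\<dots> = sqfree_prob * (1 - stop_prob n)"
      by (simp add: UNIV_bool coin walk)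
    finally show ?thesis
      by (subst prob_neg) auto
  qed
  \<comment> \<open>Second use: the ten whole subtrees, each including its root.\<close>
  let ?S = "\<lambda>d. insert (10 * y + d) (extensions (10 * y + d))"
  let ?E = "\<lambda>d \<omega>. \<not> (\<omega> (10 * y + d) \<and> has_walk \<omega> (10 * y + d) n)"
  have "\<P>(\<omega> in ?M. \<not> has_walk \<omega> y (Suc n)) = \<P>(\<omega> in ?M. \<forall>d\<in>{..<10}. ?E d \<omega>)"
    by (intro prob_cong_space) auto
  also have "\<dots> = (\<Prod>d<10. \<P>(\<omega> in ?M. ?E d \<omega>))"
  proof (rule prob_disjoint_blocks[where S = ?S])
    show "disjoint_family_on ?S {..<10}"
      using Suc.prems(1) by (rule disjoint_family_extensions)
    show "Measurable.pred (PiM (?S d) (\<lambda>_. sqfree_coin)) (?E d)" for d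
      by (intro pred_intros_logic pred_coordinate pred_has_walk) auto
    show "?E d (restrict \<omega> (?S d)) = ?E d \<omega>" for d \<omega>
      by (subst has_walk_restrict) auto
    show "?S d \<subseteq> I" if "d \<in> {..<10}" for d
      using Suc.prems that by (auto intro: extensions_trans extensions.base)
  qed (auto intro: measure_pmf.prob_space_axioms simp: lessThan_empty_iff)
  also have "\<dots> = stop_prob (Suc n)"
    by (simp add: z del: de_Morgan_conj)
  finally show ?case .
qed simp

subsection \<open>The limit of the stopping probabilities\<close>

lemma stop_prob_bounds: "0 \<le> stop_prob k" "stop_prob k \<le> 0.00009"
proof (induction k)
  case (Suc k)
  let ?q = "1 - sqfree_prob * (1 - stop_prob k)"
  \<comment> \<open>The two estimates place the base between 0 and 0.3922, and
    \<open>0.3922 ^ 10\<close> is about 0.0000861, below the invariant bound 0.00009.\<close>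
  have "0.6079 * (1 - 0.00009) \<le> sqfree_prob * (1 - stop_prob k)"
    using Suc sqfree_prob_bounds by (intro mult_mono) auto
  moreover have "sqfree_prob * (1 - stop_prob k) \<le> 0.60796 * 1"
    using Suc sqfree_prob_bounds by (intro mult_mono) auto
  ultimately have "0 \<le> ?q" "?q \<le> 0.3922" by auto
  then have "?q ^ 10 \<le> 0.3922 ^ 10" by (intro power_mono)
  with \<open>0 \<le> ?q\<close> show "0 \<le> stop_prob (Suc k)" "stop_prob (Suc k) \<le> 0.00009"
    by (auto simp: power_divide)
qed simp_all

text \<open>The recursion map is increasing while its base is nonnegative, and the first step goes
  up from 0.\<close>

lemma incseq_stop_prob: "incseq stop_prob"
proof (rule incseq_SucI)
  show "stop_prob k \<le> stop_prob (Suc k)" for k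
  proof (induction k)
    case (Suc k)
    have "sqfree_prob * (1 - stop_prob k) \<le> 1 * 1"
      using stop_prob_bounds[of k] sqfree_prob_bounds by (intro mult_mono) auto
    with Suc sqfree_prob_bounds show ?case
      by (auto intro!: power_mono mult_left_mono simp del: stop_prob.simps(2)
          simp: stop_prob.simps(2)[of k] stop_prob.simps(2)[of "Suc k"])
  qed (simp add: stop_prob_bounds)
qed

lemma stop_prob_1_gt: "0.000085 < stop_prob 1"
proof -
  \<comment> \<open>Here \<open>0.39204 = 1 - 0.60796\<close>, and its tenth power is about
    0.0000857.\<close>
  have "0.39204 ^ 10 \<le> (1 - sqfree_prob) ^ 10"
    using sqfree_prob_bounds by (intro power_mono) auto
  then show ?thesis by (simp add: power_divide)
qed

lemma stop_prob_limit:
  obtains l where "stop_prob \<longlonglongrightarrow> l" "0.000085 < l" "l \<le> 0.00009"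
proof -
  obtain l where l: "stop_prob \<longlonglongrightarrow> l" "\<And>k. stop_prob k \<le> l"
    using incseq_convergent[OF incseq_stop_prob, of "0.00009"] stop_prob_bounds by blast
  have "l \<le> 0.00009"
    using l(1) stop_prob_bounds by (intro LIMSEQ_le_const2[OF l(1)]) auto
  with l that[of l] stop_prob_1_gt l(2)[of 1] show thesis by linarith
qed

theorem theorem3p4:
  shows "\<exists>(P :: nat \<Rightarrow> real) (l :: real).
    (\<forall>x>0. \<forall>k\<ge>1. walk_prob x k = P k) \<and>
    P \<longlonglongrightarrow> l \<and>
    \<bar>(1 - l) - 0.99991\<bar> < 0.000005 \<and>
    (\<forall>x>0. \<P>(\<omega> in sqfree_model x. \<exists>w. sqfree_walk \<omega> x \<infinity> w) \<ge> 1 - l)"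
proof -
  obtain l where l: "stop_prob \<longlonglongrightarrow> l" "0.000085 < l" "l \<le> 0.00009"
    by (rule stop_prob_limit)
  have walk: "walk_prob x k = stop_prob k" if "0 < x" for x k
    unfolding walk_prob_def longest_walk_length_le_iff sqfree_model_eq
    using that by (rule prob_no_walk) simp
  have inf: "\<P>(\<omega> in sqfree_model x. \<exists>w. sqfree_walk \<omega> x \<infinity> w) = 1 - l" if "0 < x" for x
  proof -
    let ?M = "sqfree_model x"
    interpret prob_space ?M
      unfolding sqfree_model_eq by (rule prob_space_PiM) (rule measure_pmf.prob_space_axioms)
    have [measurable]: "Measurable.pred ?M (\<lambda>\<omega>. has_walk \<omega> x n)" for n
      unfolding sqfree_model_eq by (rule pred_has_walk) simp
    let ?A = "\<lambda>n. {\<omega> \<in> space ?M. has_walk \<omega> x n}"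
    have "prob (?A n) = 1 - stop_prob n" for n
      using prob_no_walk[OF that order_refl, of n, folded sqfree_model_eq]
        prob_neg[of "\<lambda>\<omega>. has_walk \<omega> x n"] by simp
    \<comment> \<open>The events decrease in \<open>n\<close>, so continuity from above applies;
      their intersection is the event of an infinite walk by Koenig's lemma.\<close>
    moreover have "(\<lambda>n. prob (?A n)) \<longlonglongrightarrow> prob (\<Inter>n. ?A n)"
      by (rule finite_Lim_measure_decseq) (auto simp: decseq_def intro: has_walk_antimono)
    moreover have "(\<lambda>n. 1 - stop_prob n) \<longlonglongrightarrow> 1 - l"
      by (intro tendsto_intros l)
    ultimately have "prob (\<Inter>n. ?A n) = 1 - l"
      using LIMSEQ_unique by fastforce
    moreover have "(\<Inter>n. ?A n) = {\<omega> \<in> space ?M. \<exists>w. sqfree_walk \<omega> x \<infinity> w}"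
      by (auto simp: ex_infinite_walk_iff)
    ultimately show ?thesis by simp
  qed
  show ?thesis
  proof (intro exI conjI allI impI)
    \<comment> \<open>The difference equals \<open>0.00009 - l\<close>, which is nonnegative and, by
      the strict lower bound on \<open>l\<close>, less than 0.000005.\<close>
    show "\<bar>(1 - l) - 0.99991\<bar> < 0.000005"
      using l(2,3) by (simp add: abs_if)
  qed (use l walk inf in auto)
qed

end
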